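(* Let $\mathcal H$ be a real Hilbert space, $p^*\in\mathcal H$, and let $(T_k)_{k\ge 1}$ be a sequence of operators $T_k:\mathcal H\to\mathcal H$ such that, for each $k\ge 1$, $\mathrm{Fix}(T_k)=\{p^*\}$ and $T_k$ is $q_k$-quasi-contractive, with $q_k\in(0,1)$. Let $(\alpha_k)_{k\ge 0}$ be a nondecreasing sequence in $[0,1)$, write $\alpha:=\sup_{k\ge 1}\alpha_k$, and let $(\lambda_k)_{k\ge 0}$ be a sequence in $(0,1)$. Let $x_0,x_1\in\mathcal H$ and let $(x_k,y_k)$ satisfy, for $k\ge 1$, $$y_k=x_k+\alpha_k(x_k-x_{k-1}),\qquad x_{k+1}=(1-\lambda_k)y_k+\lambda_kT_ky_k.$$ Let $\xi\in[0,1]$, write $\nu_k=\lambda_k^{-1}-1$ for $k\ge 0$ and $Q_k=Q(\lambda_k,q_k,\xi)$ for $k\ge 1$, and assume that $$Q_k\alpha_k(1+\alpha_k)+\xi\nu_k\alpha_k(1-\alpha_k)-\xi Q_k\nu_{k-1}(1-\alpha_{k-1})\le 0\quad\text{for all }k\ge 1.$$ Then: (i) If $\sum_{k=1}^\infty\lambda_k(1-q_k^2)=\infty$, then $x_k$ converges strongly to $p^*$ as $k\to\infty$. (ii) If $\lambda_k\ge\lambda>0$ and $q_k\le q<1$ for all $k\ge 1$, then $x_k$ converges linearly to $p^*$ as $k\to\infty$. More precisely, for all $k\ge 1$, $$\|x_{k+1}-p^*\|^2\le\left[\frac{Q(\lambda,q,\xi)^{k+1}-\alpha^{k+1}}{Q(\lambda,q,\xi)-\alpha}\right]\|x_1-p^*\|^2=\mathcal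 O\left(Q(\lambda,q,\xi)^k\right).$$
   Context: $\mathrm{Fix}(T)$ denotes the set of fixed points of $T$. Given $q\in(0,1)$, an operator $T:\mathcal H\to\mathcal H$ is $q$-quasi-contractive if $\mathrm{Fix}(T)\ne\emptyset$ and $\|Ty-p\|\le q\|y-p\|$ for all $y\in\mathcal H$ and $p\in\mathrm{Fix}(T)$. For $\lambda,q\in(0,1)$ and $\xi\in[0,1]$, $$Q(\lambda,q,\xi):=\xi\big(1-\lambda+\lambda q^2\big)+(1-\xi)(1-\lambda+\lambda q)^2=(1-\lambda+\lambda q)^2+\xi\lambda(1-\lambda)(1-q)^2.$$
   Formalization: Part (i) is proved under the added assumption α<1, and the explicit estimate in (ii) under x_0=x_1, since each fails without it; linear convergence and the O(Q(λ,q,ξ)^k) rate for the squared error are proved for arbitrary x_0, x_1. *)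

theory Defs
  imports "HOL-Analysis.Analysis" "HOL-Library.Landau_Symbols"
begin

definition Fix :: "('a \<Rightarrow> 'a) \<Rightarrow> 'a set" where
  "Fix T = {p. T p = p}"

definition quasi_contractive :: "real \<Rightarrow> ('a::real_normed_vector \<Rightarrow> 'a) \<Rightarrow> bool" where
  "quasi_contractive q T \<longleftrightarrow>
     Fix T \<noteq> {} \<and> (\<forall>y. \<forall>p\<in>Fix T. norm (T y - p) \<le> q * norm (y - p))"

definition Q :: "real \<Rightarrow> real \<Rightarrow> real \<Rightarrow> real" where
  "Q l q \<xi> = \<xi> * (1 - l + l * q\<^sup>2) + (1 - \<xi>) * (1 - l + l * q)\<^sup>2"

lemma Q_alt: "Q l q \<xi> = (1 - l + l * q)\<^sup>2 + \<xi> * l * (1 - l) * (1 - q)\<^sup>2"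
  unfolding Q_def by (simp add: power2_eq_square algebra_simps)

(* R-linear convergence: the error is dominated by a geometric sequence. Errors such as the ones
   considered here need not decrease monotonically, so no bound on the ratio of consecutive
   errors is meant. *)
definition converges_linearly :: "(nat \<Rightarrow> 'a::real_normed_vector) \<Rightarrow> 'a \<Rightarrow> bool" where
  "converges_linearly x p \<longleftrightarrow>
     (\<exists>C r. 0 < r \<and> r < 1 \<and> (\<forall>k. norm (x k - p) \<le> C * r ^ k))"

end

theory Submission
  imports Defs
begin

text \<open>Put \<open>D\<^sub>k = \<parallel>x\<^sub>k - p\<parallel>\<^sup>2\<close> and \<open>E\<^sub>k = \<xi> \<nu>\<^sub>k\<^sub>-\<^sub>1 (1 - \<alpha>\<^sub>k\<^sub>-\<^sub>1) \<parallel>x\<^sub>k - x\<^sub>k\<^sub>-\<^sub>1\<parallel>\<^sup>2\<close>. Bounding \<open>D\<^sub>k\<^sub>+\<^sub>1\<close> in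
  two ways (by the convexity identity for the squared norm, and by the triangle inequality) and
  taking the \<open>\<xi>\<close>-average, the parameter condition yields \<open>C\<^sub>k\<^sub>+\<^sub>1 \<le> Q\<^sub>k C\<^sub>k\<close> for
  \<open>C\<^sub>k = D\<^sub>k + E\<^sub>k - \<alpha>\<^sub>k\<^sub>-\<^sub>1 D\<^sub>k\<^sub>-\<^sub>1\<close>. Hence \<open>D\<^sub>k\<^sub>+\<^sub>1 \<le> \<alpha> D\<^sub>k + Q\<^sub>1\<cdots>Q\<^sub>k max(C\<^sub>1, 0)\<close>, and both claims
  follow by unrolling this recursion. That \<open>\<alpha> < Q\<close> holds in the second claim is a consequence of
  the parameter condition: otherwise \<open>\<xi> \<nu>\<^sub>k (1 - \<alpha>\<^sub>k)\<close> would eventually decrease by a fixed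
  positive amount at every step.\<close>

section \<open>Identities for squared norms in an inner product space\<close>

lemma norm_extrapolate_square:
  fixes u v :: "'a::real_inner"
  shows "(norm (u + a *\<^sub>R (u - v)))\<^sup>2
    = (1 + a) * (norm u)\<^sup>2 - a * (norm v)\<^sup>2 + a * (1 + a) * (norm (u - v))\<^sup>2"
  unfolding power2_norm_eq_inner
  by (simp add: inner_diff inner_add inner_commute algebra_simps power2_eq_square)

lemma norm_convex_combination_square:
  fixes u v :: "'a::real_inner"
  shows "(norm ((1 - l) *\<^sub>R u + l *\<^sub>R v))\<^sup>2
    = (1 - l) * (norm u)\<^sup>2 + l * (norm v)\<^sup>2 - l * (1 - l) * (norm (u - v))\<^sup>2"
  unfolding power2_norm_eq_inner
  by (simp add: inner_diff inner_add inner_commute algebra_simps power2_eq_square)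

text \<open>The two sides differ by exactly \<open>a * (norm (u - v))\<^sup>2\<close>. Applied to
  the increments \<open>w - u\<close> and \<open>u - v\<close> of successive iterates, this bounds
  \<open>norm (w - y)\<close> from below.\<close>

lemma norm_diff_scaleR_square_ge:
  fixes u v :: "'a::real_inner"
  assumes "0 \<le> a"
  shows "(1 - a) * (norm u)\<^sup>2 - a * (1 - a) * (norm v)\<^sup>2 \<le> (norm (u - a *\<^sub>R v))\<^sup>2"
proof -
  have "(norm (u - a *\<^sub>R v))\<^sup>2
      = (1 - a) * (norm u)\<^sup>2 - a * (1 - a) * (norm v)\<^sup>2 + a * (norm (u - v))\<^sup>2"
    unfolding power2_norm_eq_inner
    by (simp add: inner_diff inner_commute algebra_simps power2_eq_square)
  then show ?thesis
    using assms by simp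
qed

section \<open>The averaged contraction factor \<open>Q\<close>\<close>

lemma relaxed_factor_square_le:
  fixes l q :: real
  assumes "0 \<le> l" "l \<le> 1"
  shows "(1 - l + l * q)\<^sup>2 \<le> 1 - l + l * q\<^sup>2"
proof -
  have "1 - l + l * q\<^sup>2 - (1 - l + l * q)\<^sup>2 = l * (1 - l) * (1 - q)\<^sup>2"
    by (simp add: power2_eq_square algebra_simps)
  also have "\<dots> \<ge> 0"
    using assms by simp
  finally show ?thesis by simp
qed

lemma Q_pos:
  assumes "0 \<le> l" "l \<le> 1" "0 < q" "0 \<le> \<xi>"
  shows "0 < Q l q \<xi>"
proof -
  have "0 < 1 - l + l * q"
    using assms by (cases "l = 0") (auto intro: add_nonneg_pos)
  then show ?thesis
    unfolding Q_alt using assms by (intro add_pos_nonneg) auto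
qed

text \<open>Of the two factors averaged in \<open>Q\<close>, the larger is
  \<open>1 - l + l * q\<^sup>2\<close>, by convexity of the square. This relates \<open>Q\<close> to
  the terms of the series in the first claim.\<close>

lemma Q_le:
  assumes "0 \<le> l" "l \<le> 1" "\<xi> \<le> 1"
  shows "Q l q \<xi> \<le> 1 - l * (1 - q\<^sup>2)"
proof -
  have "(1 - \<xi>) * (1 - l + l * q)\<^sup>2 \<le> (1 - \<xi>) * (1 - l + l * q\<^sup>2)"
    using relaxed_factor_square_le[OF assms(1,2)] assms(3) by (intro mult_left_mono) auto
  then show ?thesis
    unfolding Q_def by (simp add: algebra_simps)
qed

lemma Q_less_one:
  assumes "0 < l" "l \<le> 1" "0 \<le> q" "q < 1" "\<xi> \<le> 1"
  shows "Q l q \<xi> < 1"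
proof -
  have "q\<^sup>2 < 1"
    using assms by (simp add: power_less_one_iff abs_square_less_1)
  then have "0 < l * (1 - q\<^sup>2)"
    using assms by simp
  then show ?thesis
    using Q_le[of l \<xi> q] assms by simp
qed

text \<open>Both averaged factors shrink when the relaxation grows and the contraction constant
  falls. So \<open>Q\<close> at the extreme parameters bounds the factors of all steps.\<close>

lemma Q_mono:
  assumes "0 \<le> l" "l \<le> l'" "l' \<le> 1" "0 \<le> q'" "q' \<le> q" "q \<le> 1" "0 \<le> \<xi>" "\<xi> \<le> 1"
  shows "Q l' q' \<xi> \<le> Q l q \<xi>"
proof -
  have "q\<^sup>2 \<le> 1" "q'\<^sup>2 \<le> q\<^sup>2"
    using assms by (auto simp: abs_square_le_1)
  then have "l * (1 - q\<^sup>2) \<le> l' * (1 - q'\<^sup>2)" "l * (1 - q) \<le> l' * (1 - q')"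
    using assms by (auto intro!: mult_mono)
  then have le: "1 - l' + l' * q'\<^sup>2 \<le> 1 - l + l * q\<^sup>2" "1 - l' + l' * q' \<le> 1 - l + l * q"
    by (simp_all add: algebra_simps)
  have "(1 - l' + l' * q')\<^sup>2 \<le> (1 - l + l * q)\<^sup>2"
    using le(2) assms by (intro power_mono) auto
  then show ?thesis
    unfolding Q_def using mult_left_mono[OF le(1), of \<xi>] mult_left_mono[of _ _ "1 - \<xi>"] assms
    by (meson add_mono diff_ge_0_iff_ge)
qed

section \<open>Estimates for a single step\<close>

text \<open>The convexity identity (\<open>A\<close>) keeps a negative multiple of
  \<open>(norm (w - y))\<^sup>2\<close> at the price of the larger factor; the triangle inequality
  (\<open>B\<close>) has the smaller factor but nothing to subtract. The weight \<open>\<xi>\<close>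
  trades one against the other.\<close>

lemma relaxed_step_bound:
  fixes y z p :: "'a::real_inner"
  assumes l: "0 < l" "l \<le> 1" and q: "0 \<le> q" and \<xi>: "0 \<le> \<xi>" "\<xi> \<le> 1"
    and z: "norm (z - p) \<le> q * norm (y - p)"
    and w: "w = (1 - l) *\<^sub>R y + l *\<^sub>R z"
  shows "(norm (w - p))\<^sup>2 \<le> Q l q \<xi> * (norm (y - p))\<^sup>2 - \<xi> * (1 / l - 1) * (norm (w - y))\<^sup>2"
proof -
  define Y where "Y = norm (y - p)"
  have wp: "w - p = (1 - l) *\<^sub>R (y - p) + l *\<^sub>R (z - p)"
    unfolding w by (simp add: algebra_simps)
  have "(norm (z - p))\<^sup>2 \<le> (q * Y)\<^sup>2"
    using z unfolding Y_def by (intro power_mono) auto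
  then have "l * (norm (z - p))\<^sup>2 \<le> l * (q\<^sup>2 * Y\<^sup>2)"
    using l by (intro mult_left_mono) (auto simp: power_mult_distrib)
  moreover have "(norm (w - y))\<^sup>2 = l\<^sup>2 * (norm (y - z))\<^sup>2"
  proof -
    have "w - y = l *\<^sub>R (z - y)"
      unfolding w by (simp add: algebra_simps)
    then show ?thesis
      by (simp add: power_mult_distrib norm_minus_commute)
  qed
  \<comment> \<open>The weight \<nu> originates here, from \<open>w - y\<close> being
    \<open>l\<close> times \<open>z - y\<close>.\<close>
  then have "l * (1 - l) * (norm (y - z))\<^sup>2 = (1 / l - 1) * (norm (w - y))\<^sup>2"
    using l by (simp add: field_simps power2_eq_square)
  ultimately have A: "(norm (w - p))\<^sup>2 \<le> (1 - l + l * q\<^sup>2) * Y\<^sup>2 - (1 / l - 1) * (norm (w - y))\<^sup>2"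
    using norm_convex_combination_square[of l "y - p" "z - p"]
    unfolding wp[symmetric] Y_def by (simp add: algebra_simps)
  have "norm (w - p) \<le> (1 - l) * Y + l * norm (z - p)"
    unfolding wp Y_def using l by (intro norm_triangle_le) simp
  also have "\<dots> \<le> (1 - l) * Y + l * (q * Y)"
    using z l unfolding Y_def by simp
  also have "\<dots> = (1 - l + l * q) * Y"
    by (simp add: algebra_simps)
  finally have "(norm (w - p))\<^sup>2 \<le> ((1 - l + l * q) * Y)\<^sup>2"
    by (intro power_mono) auto
  then have B: "(norm (w - p))\<^sup>2 \<le> (1 - l + l * q)\<^sup>2 * Y\<^sup>2"
    by (simp only: power_mult_distrib)
  have "(norm (w - p))\<^sup>2 = \<xi> * (norm (w - p))\<^sup>2 + (1 - \<xi>) * (norm (w - p))\<^sup>2"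
    by (simp add: algebra_simps)
  also have "\<dots> \<le> \<xi> * ((1 - l + l * q\<^sup>2) * Y\<^sup>2 - (1 / l - 1) * (norm (w - y))\<^sup>2)
      + (1 - \<xi>) * ((1 - l + l * q)\<^sup>2 * Y\<^sup>2)"
    using A B \<xi> by (intro add_mono mult_left_mono) auto
  also have "\<dots> = Q l q \<xi> * Y\<^sup>2 - \<xi> * (1 / l - 1) * (norm (w - y))\<^sup>2"
    unfolding Q_def by (simp only: algebra_simps)
  finally show ?thesis
    unfolding Y_def .
qed

text \<open>Extrapolation contributes one multiple of \<open>(norm (u - v))\<^sup>2\<close>, the
  lower bound on \<open>norm (w - y)\<close> another; \<open>cond\<close> lets
  \<open>Q l q \<xi> * c\<close> absorb both. In the iteration, \<open>c\<close> is the weight that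
  the previous step left on this increment.\<close>

lemma inertial_step_bound:
  fixes u v w y z p :: "'a::real_inner"
  assumes l: "0 < l" "l \<le> 1" and q: "0 \<le> q" and \<xi>: "0 \<le> \<xi>" "\<xi> \<le> 1" and a: "0 \<le> a"
    and z: "norm (z - p) \<le> q * norm (y - p)"
    and y: "y = u + a *\<^sub>R (u - v)"
    and w: "w = (1 - l) *\<^sub>R y + l *\<^sub>R z"
    and cond: "Q l q \<xi> * a * (1 + a) + \<xi> * (1 / l - 1) * a * (1 - a) \<le> Q l q \<xi> * c"
  shows "(norm (w - p))\<^sup>2 + \<xi> * (1 / l - 1) * (1 - a) * (norm (w - u))\<^sup>2
    \<le> Q l q \<xi> * ((1 + a) * (norm (u - p))\<^sup>2 - a * (norm (v - p))\<^sup>2 + c * (norm (u - v))\<^sup>2)"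
proof -
  let ?Q = "Q l q \<xi>" and ?m = "\<xi> * (1 / l - 1)"
  let ?W = "(norm (w - u))\<^sup>2" and ?U = "(norm (u - v))\<^sup>2"
  have yp: "y - p = (u - p) + a *\<^sub>R ((u - p) - (v - p))"
    unfolding y by simp
  have wy: "w - y = (w - u) - a *\<^sub>R (u - v)"
    unfolding y by simp
  have Y: "(norm (y - p))\<^sup>2
      = (1 + a) * (norm (u - p))\<^sup>2 - a * (norm (v - p))\<^sup>2 + a * (1 + a) * ?U"
    unfolding yp norm_extrapolate_square by simp
  have "?m * ((1 - a) * ?W - a * (1 - a) * ?U) \<le> ?m * (norm (w - y))\<^sup>2"
    unfolding wy using l \<xi>(1)
    by (intro mult_left_mono norm_diff_scaleR_square_ge[OF a] mult_nonneg_nonneg) auto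
  then have "(norm (w - p))\<^sup>2 \<le> ?Q * (norm (y - p))\<^sup>2 - ?m * ((1 - a) * ?W - a * (1 - a) * ?U)"
    using relaxed_step_bound[OF l q \<xi> z w] by linarith
  moreover have "(?Q * a * (1 + a) + ?m * a * (1 - a)) * ?U \<le> ?Q * c * ?U"
    using cond by (intro mult_right_mono) auto
  ultimately show ?thesis
    unfolding Y by (simp only: algebra_simps)
qed

section \<open>Scalar recursions and infinite products\<close>

text \<open>Once \<open>b k < (1 - a) * d\<close>, the level \<open>d\<close> reproduces itself, as
  \<open>a * d + (1 - a) * d = d\<close>, and the excess over it shrinks by the factor
  \<open>a\<close> per step. Half of the tolerance goes to \<open>d\<close>, half to that
  excess.\<close>

lemma contraction_with_null_error_tendsto_0:
  fixes u b :: "nat \<Rightarrow> real"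
  assumes a: "0 \<le> a" "a < 1" and u: "\<And>k. 0 \<le> u k"
    and rec: "\<And>k. k \<ge> 1 \<Longrightarrow> u (Suc k) \<le> a * u k + b k"
    and b: "b \<longlonglongrightarrow> 0"
  shows "u \<longlonglongrightarrow> 0"
proof (rule LIMSEQ_I)
  fix e :: real
  assume "0 < e"
  define d where "d = e / 2"
  have d: "0 < d" "e = d + d"
    using \<open>0 < e\<close> by (auto simp: d_def)
  have "0 < (1 - a) * d"
    using a d by simp
  with b have "eventually (\<lambda>k. b k < (1 - a) * d) sequentially"
    by (rule order_tendstoD)
  then obtain N0 where N0: "\<And>k. k \<ge> N0 \<Longrightarrow> b k < (1 - a) * d"
    by (auto simp: eventually_sequentially)
  \<comment> \<open>The recursion is available only from index 1 on.\<close>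
  define N where "N = max 1 N0"
  have geo: "u (N + n) \<le> d + a ^ n * u N" for n
  proof (induction n)
    case 0
    then show ?case using d by simp
  next
    case (Suc n)
    have "u (Suc (N + n)) \<le> a * u (N + n) + b (N + n)"
      by (rule rec) (simp add: N_def)
    also have "\<dots> \<le> a * (d + a ^ n * u N) + (1 - a) * d"
      using Suc a less_imp_le[OF N0[of "N + n"]]
      by (intro add_mono mult_left_mono) (simp_all add: N_def)
    finally show ?case by (simp add: algebra_simps)
  qed
  have "(\<lambda>n. a ^ n * u N) \<longlonglongrightarrow> 0"
    using a by (intro tendsto_mult_left_zero LIMSEQ_power_zero) auto
  then have "eventually (\<lambda>n. a ^ n * u N < d) sequentially"
    using d by (intro order_tendstoD)
  then obtain M where M: "\<And>n. n \<ge> M \<Longrightarrow> a ^ n * u N < d"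
    by (auto simp: eventually_sequentially)
  have "norm (u n - 0) < e" if "n \<ge> N + M" for n
  proof -
    have "N + (n - N) = n" "n - N \<ge> M"
      using that by auto
    then show ?thesis
      using geo[of "n - N"] M[of "n - N"] u[of n] d by simp
  qed
  then show "\<exists>no. \<forall>n\<ge>no. norm (u n - 0) < e"
    by blast
qed

text \<open>Since \<open>1 - s \<le> exp (- s)\<close>, the product is at most the exponential of
  minus the partial sum.\<close>

lemma prod_tendsto_0_if_sum_at_top:
  fixes c s :: "nat \<Rightarrow> real"
  assumes "\<And>k. k \<ge> 1 \<Longrightarrow> 0 \<le> c k" "\<And>k. k \<ge> 1 \<Longrightarrow> c k \<le> 1 - s k"
    and "filterlim (\<lambda>n. \<Sum>k=1..n. s k) at_top sequentially"
  shows "(\<lambda>n. \<Prod>k=1..n. c k) \<longlonglongrightarrow> 0"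
proof (rule tendsto_sandwich)
  show "eventually (\<lambda>n. 0 \<le> (\<Prod>k=1..n. c k)) sequentially"
    using assms(1) by (auto intro!: always_eventually prod_nonneg)
  have "c k \<le> exp (- s k)" if "k \<ge> 1" for k
    using assms(2)[OF that] exp_ge_add_one_self[of "- s k"] by linarith
  then have "(\<Prod>k=1..n. c k) \<le> exp (- (\<Sum>k=1..n. s k))" for n
    using assms(1) by (auto simp: exp_sum sum_negf[symmetric] intro!: prod_mono)
  then show "eventually (\<lambda>n. (\<Prod>k=1..n. c k) \<le> exp (- (\<Sum>k=1..n. s k))) sequentially"
    by simp
  show "(\<lambda>n. exp (- (\<Sum>k=1..n. s k))) \<longlonglongrightarrow> 0"
    using assms(3)
    by (intro filterlim_compose[OF exp_at_bot]) (simp add: filterlim_uminus_at_top)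
qed simp

lemma geometric_recursion_bound:
  fixes u :: "nat \<Rightarrow> real"
  assumes ac: "0 \<le> a" "a < c" and M: "0 \<le> M" and u: "0 \<le> u 1"
    and rec: "\<And>k. k \<ge> 1 \<Longrightarrow> u (Suc k) \<le> a * u k + c ^ k * M"
  shows "u (Suc k) \<le> (u 1 + c * M / (c - a)) * c ^ k"
proof (induction k)
  case 0
  then show ?case using assms by simp
next
  case (Suc k)
  \<comment> \<open>The summand \<open>u 1\<close> serves the base case. The induction step needs
    \<open>a * ?K + c * M \<le> ?K * c\<close>, which the other summand alone satisfies with
    equality.\<close>
  let ?K = "u 1 + c * M / (c - a)"
  have "c * M = c * M / (c - a) * (c - a)"
    using ac by simp
  also have "\<dots> \<le> ?K * (c - a)"
    using ac u by (intro mult_right_mono) auto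
  finally have KM: "a * ?K + c * M \<le> ?K * c"
    by (simp only: algebra_simps)
  have "u (Suc (Suc k)) \<le> a * u (Suc k) + c ^ Suc k * M"
    by (rule rec) simp
  also have "\<dots> \<le> a * (?K * c ^ k) + c ^ Suc k * M"
    using Suc.IH ac by (intro add_right_mono mult_left_mono) auto
  also have "\<dots> = (a * ?K + c * M) * c ^ k"
    by (simp only: power_Suc algebra_simps)
  also have "\<dots> \<le> (?K * c) * c ^ k"
    using KM ac by (intro mult_right_mono) auto
  finally show ?case by (simp only: power_Suc mult.assoc)
qed

text \<open>The right-hand side solves the recursion with equality: its quotient is the sum of all
  \<open>c ^ i * a ^ (k - i)\<close> with \<open>i \<le> k\<close>.\<close>

lemma geometric_recursion_exact_bound:
  fixes u :: "nat \<Rightarrow> real"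
  assumes ac: "0 \<le> a" "a \<noteq> c"
    and rec: "\<And>k. k \<ge> 1 \<Longrightarrow> u (Suc k) \<le> a * u k + c ^ k * u 1"
  shows "u (Suc k) \<le> (c ^ Suc k - a ^ Suc k) / (c - a) * u 1"
proof (induction k)
  case 0
  then show ?case using ac by simp
next
  case (Suc k)
  have "u (Suc (Suc k)) \<le> a * u (Suc k) + c ^ Suc k * u 1"
    by (rule rec) simp
  also have "\<dots> \<le> a * ((c ^ Suc k - a ^ Suc k) / (c - a) * u 1) + c ^ Suc k * u 1"
    using Suc.IH ac by (intro add_right_mono mult_left_mono) auto
  also have "\<dots> = (c ^ Suc (Suc k) - a ^ Suc (Suc k)) / (c - a) * u 1"
    using ac by (simp add: field_simps)
  finally show ?case .
qed

section \<open>Strict gap between the inertia limit and the contraction factor\<close>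

lemma no_uniform_decrease:
  fixes e :: "nat \<Rightarrow> real"
  assumes "\<And>k. 0 \<le> e k" "0 < d" "\<And>k. k \<ge> N \<Longrightarrow> e (Suc k) \<le> e k - d"
  shows False
proof -
  have dec: "e (N + n) \<le> e N - real n * d" for n
  proof (induction n)
    case (Suc n)
    then show ?case
      using assms(3)[of "N + n"] by (simp add: algebra_simps)
  qed simp
  obtain n where "e N < real n * d"
    using reals_Archimedean3[OF assms(2)] by blast
  then show False
    using dec[of n] assms(1)[of "N + n"] by linarith
qed

text \<open>Applied with \<open>e k = \<xi> * \<nu> k * (1 - \<alpha> k)\<close>, for which the hypothesis \<open>cond\<close> is the parameter
  condition.\<close>

lemma limit_less_if_parameter_condition:
  fixes a e c :: "nat \<Rightarrow> real"
  assumes a: "a \<longlonglongrightarrow> A" "\<And>k. 0 \<le> a k" "\<And>k. k \<ge> 1 \<Longrightarrow> a k \<le> A"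
    and e: "\<And>k. 0 \<le> e k" "\<And>k. k \<ge> 1 \<Longrightarrow> e k \<le> B"
    and c: "\<And>k. k \<ge> 1 \<Longrightarrow> 0 < c k" "\<And>k. k \<ge> 1 \<Longrightarrow> c k \<le> R"
    and cond: "\<And>k. k \<ge> 1 \<Longrightarrow> c k * a k * (1 + a k) + e k * a k \<le> c k * e (k - 1)"
  shows "A < R"
proof (rule ccontr)
  assume "\<not> A < R"
  then have RA: "R \<le> A" by simp
  have "0 < R"
    using c[of 1] by simp
  then have A: "0 < A"
    using RA by simp
  have B: "0 \<le> B"
    using e[of 1] by simp
  \<comment> \<open>The first entry forces \<open>a k \<ge> A / 2\<close>; the second keeps
    \<open>(A - a k) * e k\<close> below \<open>A\<^sup>2 / 4\<close>. The denominator has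
    \<open>B + 1\<close> because \<open>B\<close> may be 0.\<close>
  define t where "t = min (A / 2) (A\<^sup>2 / (4 * (B + 1)))"
  have t: "0 < t"
    using A B by (simp add: t_def)
  have "eventually (\<lambda>k. A - t < a k) sequentially"
    using t by (intro order_tendstoD(1)[OF a(1)]) simp
  then obtain N where N: "\<And>k. k \<ge> N \<Longrightarrow> A - t < a k"
    by (auto simp: eventually_sequentially)
  \<comment> \<open>As \<open>c\<close> is at most \<open>A\<close>, \<open>cond\<close> gives
    \<open>e (Suc k) * a (Suc k) \<le> A * (e k - A / 2)\<close>. Replacing \<open>a (Suc k)\<close>
    by \<open>A\<close> on the left costs at most \<open>A * (A / 4)\<close>, which leaves a drop of
    \<open>A / 4\<close>.\<close>
  have "e (Suc k) \<le> e k - A / 4" if "k \<ge> N" for k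
  proof -
    let ?k = "Suc k"
    have "t \<le> A / 2" "t \<le> A\<^sup>2 / (4 * (B + 1))"
      unfolding t_def by (rule min.cobounded1, rule min.cobounded2)
    then have ak: "A / 2 \<le> a ?k" and Aak: "A - a ?k \<le> A\<^sup>2 / (4 * (B + 1))"
      using N[of ?k] that by linarith+
    have "c ?k * (e k - a ?k * (1 + a ?k)) \<ge> e ?k * a ?k"
      using cond[of ?k] by (simp add: algebra_simps)
    moreover have "0 \<le> e ?k * a ?k"
      using e(1) a(2) by simp
    ultimately have "0 \<le> c ?k * (e k - a ?k * (1 + a ?k))"
      by linarith
    \<comment> \<open>This sign permits replacing the factor \<open>c\<close> by the larger
      \<open>A\<close>.\<close>
    then have nonneg: "0 \<le> e k - a ?k * (1 + a ?k)"
      using c(1)[of ?k] by (simp add: zero_le_mult_iff)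
    have "e ?k * a ?k \<le> c ?k * (e k - a ?k * (1 + a ?k))"
      by fact
    also have "\<dots> \<le> A * (e k - a ?k * (1 + a ?k))"
      using c(2)[of ?k] RA nonneg by (intro mult_right_mono) auto
    also have "\<dots> \<le> A * (e k - A / 2)"
    proof -
      have "a ?k \<le> a ?k * (1 + a ?k)"
        using a(2)[of ?k] by (simp add: algebra_simps)
      then have "A / 2 \<le> a ?k * (1 + a ?k)"
        using ak by linarith
      then show ?thesis
        using A by (intro mult_left_mono diff_left_mono) auto
    qed
    finally have "e ?k * a ?k \<le> A * (e k - A / 2)" .
    moreover have "(A - a ?k) * e ?k \<le> A * (A / 4)"
    proof -
      have "(A - a ?k) * e ?k \<le> A\<^sup>2 / (4 * (B + 1)) * (B + 1)"
        using Aak e(2)[of ?k] e(1)[of ?k] B a(3)[of ?k] by (intro mult_mono) auto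
      also have "\<dots> = A * (A / 4)"
        using B by (simp add: power2_eq_square divide_simps)
      finally show ?thesis .
    qed
    ultimately have "A * e ?k \<le> A * (e k - A / 4)"
      by (simp add: algebra_simps)
    then show ?thesis
      using A by simp
  qed
  then show False
    using A e(1) no_uniform_decrease[of e "A / 4" N] by simp
qed

section \<open>Convergence of the inertial iteration\<close>

theorem theorem9:
  fixes p :: "'a::{real_inner, complete_space}"
    and T :: "nat \<Rightarrow> 'a \<Rightarrow> 'a"
    and q \<alpha> lam \<nu> :: "nat \<Rightarrow> real"
    and \<xi> \<alpha>sup :: real
    and x y :: "nat \<Rightarrow> 'a"
  assumes "\<And>k. k \<ge> 1 \<Longrightarrow> 0 < q k \<and> q k < 1"
    and "\<And>k. k \<ge> 1 \<Longrightarrow> Fix (T k) = {p}"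
    and "\<And>k. k \<ge> 1 \<Longrightarrow> quasi_contractive (q k) (T k)"
    and "mono \<alpha>"
    and "\<And>k. 0 \<le> \<alpha> k \<and> \<alpha> k < 1"
    and "\<alpha>sup = (SUP k\<in>{1..}. \<alpha> k)"
    and "\<And>k. 0 < lam k \<and> lam k < 1"
    and "\<And>k. k \<ge> 1 \<Longrightarrow> y k = x k + \<alpha> k *\<^sub>R (x k - x (k - 1))"
    and "\<And>k. k \<ge> 1 \<Longrightarrow> x (k + 1) = (1 - lam k) *\<^sub>R y k + lam k *\<^sub>R T k (y k)"
    and "0 \<le> \<xi>" and "\<xi> \<le> 1"
    and "\<And>k. \<nu> k = 1 / lam k - 1"
    and "\<And>k. k \<ge> 1 \<Longrightarrow>
           Q (lam k) (q k) \<xi> * \<alpha> k * (1 + \<alpha> k) + \<xi> * \<nu> k * \<alpha> k * (1 - \<alpha> k)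
             - \<xi> * Q (lam k) (q k) \<xi> * \<nu> (k - 1) * (1 - \<alpha> (k - 1)) \<le> 0"
  shows "(\<alpha>sup < 1 \<longrightarrow>
            filterlim (\<lambda>n. \<Sum>k=1..n. lam k * (1 - (q k)\<^sup>2)) at_top sequentially \<longrightarrow>
            x \<longlonglongrightarrow> p)
       \<and> (\<forall>l r. 0 < l \<longrightarrow> r < 1 \<longrightarrow> (\<forall>k\<ge>1. l \<le> lam k \<and> q k \<le> r) \<longrightarrow>
            converges_linearly x p
          \<and> Q l r \<xi> \<noteq> \<alpha>sup
          \<and> (x 0 = x 1 \<longrightarrow>
               (\<forall>k\<ge>1. (norm (x (k + 1) - p))\<^sup>2
                  \<le> (Q l r \<xi> ^ (k + 1) - \<alpha>sup ^ (k + 1)) / (Q l r \<xi> - \<alpha>sup)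
                      * (norm (x 1 - p))\<^sup>2))
          \<and> (\<lambda>k. (Q l r \<xi> ^ (k + 1) - \<alpha>sup ^ (k + 1)) / (Q l r \<xi> - \<alpha>sup)
                      * (norm (x 1 - p))\<^sup>2) \<in> O(\<lambda>k. Q l r \<xi> ^ k)
          \<and> (\<lambda>k. (norm (x (k + 1) - p))\<^sup>2) \<in> O(\<lambda>k. Q l r \<xi> ^ k))"
proof -
  note q = assms(1) and qc = assms(3) and \<alpha> = assms(5) and lam = assms(7)
    and \<xi> = assms(10,11) and \<nu> = assms(12)
  define c where "c k = Q (lam k) (q k) \<xi>" for k
  define D where "D k = (norm (x k - p))\<^sup>2" for k
  define e where "e k = \<xi> * \<nu> k * (1 - \<alpha> k)" for k
  define C where "C k = D k + e (k - 1) * (norm (x k - x (k - 1)))\<^sup>2 - \<alpha> (k - 1) * D (k - 1)" for k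
  \<comment> \<open>\<open>C 1\<close> may be negative; its positive part allows
    \<open>P k * M\<close> to be enlarged by enlarging \<open>P k\<close>.\<close>
  define M where "M = max (C 1) 0"
  define P where "P n = (\<Prod>k=1..n. c k)" for n
  have D0: "0 \<le> D k" for k
    by (simp add: D_def)
  have \<nu>0: "0 \<le> \<nu> k" for k
    using lam[of k] by (simp add: \<nu> field_simps)
  have e0: "0 \<le> e k" for k
    using \<xi>(1) \<nu>0[of k] \<alpha>[of k] by (simp add: e_def)
  have c0: "0 < c k" and c1: "c k < 1" if "k \<ge> 1" for k
    using Q_pos[of "lam k" "q k" \<xi>] Q_less_one[of "lam k" "q k" \<xi>] q[OF that] lam[of k] \<xi>
    by (auto simp: c_def)
  have P0: "0 \<le> P n" for n
    unfolding P_def using c0 by (intro prod_nonneg) (auto intro: less_imp_le)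
  have M0: "0 \<le> M"
    by (simp add: M_def)

  have bdd: "bdd_above (\<alpha> ` {1..})"
    using \<alpha> by (auto intro!: bdd_aboveI[of _ 1] less_imp_le)
  have \<alpha>_le: "\<alpha> k \<le> \<alpha>sup" if "k \<ge> 1" for k
    unfolding assms(6) using that by (intro cSUP_upper bdd) auto
  have \<alpha>sup0: "0 \<le> \<alpha>sup"
    using \<alpha>[of 1] \<alpha>_le[of 1] by simp
  have \<alpha>_lim: "\<alpha> \<longlonglongrightarrow> \<alpha>sup"
  proof (rule increasing_tendsto)
    show "eventually (\<lambda>k. \<alpha> k \<le> \<alpha>sup) sequentially"
      using \<alpha>_le by (auto simp: eventually_sequentially)
    fix b assume "b < \<alpha>sup"
    then obtain m where "b < \<alpha> m"
      unfolding assms(6) using less_cSUP_iff[OF _ bdd, of b] by auto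
    then have "b < \<alpha> k" if "k \<ge> m" for k
      using monoD[OF assms(4) that] by simp
    then show "eventually (\<lambda>k. b < \<alpha> k) sequentially"
      by (auto simp: eventually_sequentially)
  qed

  \<comment> \<open>Decay of \<open>C\<close> and the resulting recursion for the squared
    errors\<close>
  have cond: "c k * \<alpha> k * (1 + \<alpha> k) + e k * \<alpha> k \<le> c k * e (k - 1)" if "k \<ge> 1" for k
    using assms(13)[OF that] by (simp add: c_def e_def algebra_simps)

  have C_step: "C (Suc k) \<le> c k * C k" if k: "k \<ge> 1" for k
  proof -
    have "norm (T k (y k) - p) \<le> q k * norm (y k - p)"
      using qc[OF k] assms(2)[OF k] by (auto simp: quasi_contractive_def)
    moreover have "c k * \<alpha> k * (1 + \<alpha> k) + \<xi> * (1 / lam k - 1) * \<alpha> k * (1 - \<alpha> k) \<le> c k * e (k - 1)"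
      using cond[OF k] by (simp add: e_def \<nu> mult_ac)
    ultimately have "D (Suc k) + e k * (norm (x (Suc k) - x k))\<^sup>2
        \<le> c k * ((1 + \<alpha> k) * D k - \<alpha> k * D (k - 1) + e (k - 1) * (norm (x k - x (k - 1)))\<^sup>2)"
      using inertial_step_bound[of "lam k" "q k" \<xi> "\<alpha> k" "T k (y k)" p "y k" "x k" "x (k - 1)"
          "x (Suc k)" "e (k - 1)"] lam[of k] q[OF k] \<xi> \<alpha>[of k] assms(8)[OF k] assms(9)[OF k]
      by (simp add: c_def D_def e_def \<nu>)
    \<comment> \<open>Monotonicity of \<alpha> weakens \<open>- \<alpha> k * D (k - 1)\<close> to
      the term with \<open>\<alpha> (k - 1)\<close> that occurs in \<open>C k\<close>.\<close>
    also have "\<dots> \<le> c k * (C k + \<alpha> k * D k)"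
    proof -
      have "\<alpha> (k - 1) * D (k - 1) \<le> \<alpha> k * D (k - 1)"
        using monoD[OF assms(4), of "k - 1" k] D0 by (intro mult_right_mono) auto
      then show ?thesis
        using c0[OF k] by (intro mult_left_mono) (auto simp: C_def algebra_simps)
    qed
    \<comment> \<open>The factor \<open>c k < 1\<close> is given up on the surplus
      \<open>\<alpha> k * D k\<close>; moving the surplus to the left completes
      \<open>C (Suc k)\<close>.\<close>
    also have "\<dots> \<le> c k * C k + \<alpha> k * D k"
    proof -
      have "c k * (\<alpha> k * D k) \<le> 1 * (\<alpha> k * D k)"
        using c1[OF k] \<alpha>[of k] D0[of k] by (intro mult_right_mono) auto
      then show ?thesis
        by (simp add: algebra_simps)
    qed
    finally show ?thesis
      by (simp add: C_def)
  qed
  have C_le: "C (Suc k) \<le> P k * M" for k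
  proof (induction k)
    case 0
    then show ?case by (simp add: P_def M_def)
  next
    case (Suc k)
    have "C (Suc (Suc k)) \<le> c (Suc k) * C (Suc k)"
      by (rule C_step) simp
    also have "\<dots> \<le> c (Suc k) * (P k * M)"
      using Suc c0[of "Suc k"] by (intro mult_left_mono) auto
    finally show ?case
      by (simp add: P_def mult_ac)
  qed
  have D_step: "D (Suc k) \<le> \<alpha>sup * D k + P k * M" if k: "k \<ge> 1" for k
  proof -
    have "0 \<le> e k * (norm (x (Suc k) - x k))\<^sup>2"
      using e0 by simp
    then have "D (Suc k) \<le> \<alpha> k * D k + P k * M"
      using C_le[of k] by (simp add: C_def)
    also have "\<dots> \<le> \<alpha>sup * D k + P k * M"
      using \<alpha>_le[OF k] D0 by (intro add_right_mono mult_right_mono)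
    finally show ?thesis .
  qed

  \<comment> \<open>Strong convergence under divergence of the series\<close>
  have "x \<longlonglongrightarrow> p"
    if "\<alpha>sup < 1" and "filterlim (\<lambda>n. \<Sum>k=1..n. lam k * (1 - (q k)\<^sup>2)) at_top sequentially"
  proof -
    have "P \<longlonglongrightarrow> 0"
      unfolding P_def
    proof (rule prod_tendsto_0_if_sum_at_top)
      show "c k \<le> 1 - lam k * (1 - (q k)\<^sup>2)" for k
        using Q_le[of "lam k" \<xi> "q k"] lam[of k] \<xi> by (simp add: c_def)
    qed (use that c0 in \<open>auto intro: less_imp_le\<close>)
    then have "(\<lambda>k. P k * M) \<longlonglongrightarrow> 0"
      by (rule tendsto_mult_left_zero)
    then have "D \<longlonglongrightarrow> 0"
      by (intro contraction_with_null_error_tendsto_0[OF \<alpha>sup0 that(1), of D "\<lambda>k. P k * M"]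
          D0 D_step)
    then have "(\<lambda>k. sqrt (D k)) \<longlonglongrightarrow> 0"
      using tendsto_real_sqrt by fastforce
    then show ?thesis
      by (simp add: D_def LIM_zero_iff tendsto_norm_zero_iff)
  qed

  \<comment> \<open>Linear rate under uniform parameter bounds\<close>
  moreover have "converges_linearly x p
      \<and> Q l r \<xi> \<noteq> \<alpha>sup
      \<and> (x 0 = x 1 \<longrightarrow>
           (\<forall>k\<ge>1. (norm (x (k + 1) - p))\<^sup>2
              \<le> (Q l r \<xi> ^ (k + 1) - \<alpha>sup ^ (k + 1)) / (Q l r \<xi> - \<alpha>sup)
                  * (norm (x 1 - p))\<^sup>2))
      \<and> (\<lambda>k. (Q l r \<xi> ^ (k + 1) - \<alpha>sup ^ (k + 1)) / (Q l r \<xi> - \<alpha>sup)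
                  * (norm (x 1 - p))\<^sup>2) \<in> O(\<lambda>k. Q l r \<xi> ^ k)
      \<and> (\<lambda>k. (norm (x (k + 1) - p))\<^sup>2) \<in> O(\<lambda>k. Q l r \<xi> ^ k)"
    if l: "0 < l" and r: "r < 1" and lr: "\<forall>k\<ge>1. l \<le> lam k \<and> q k \<le> r" for l r
  proof -
    define R where "R = Q l r \<xi>"
    have l1: "l < 1" and r0: "0 < r"
      using lr lam[of 1] q[of 1] by force+
    have R: "0 < R" "R < 1"
      using Q_pos[of l r \<xi>] Q_less_one[of l r \<xi>] l l1 r r0 \<xi> by (auto simp: R_def)
    have cR: "c k \<le> R" if "k \<ge> 1" for k
      using Q_mono[of l "lam k" "q k" r \<xi>] l r lr lam[of k] q[OF that] \<xi> that
      by (simp add: c_def R_def less_imp_le)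
    \<comment> \<open>The lower bound \<open>l\<close> on the relaxation keeps \<open>e\<close>
      bounded, which the comparison of \<open>\<alpha>sup\<close> with \<open>R\<close> relies
      on.\<close>
    have e_le: "e k \<le> 1 / l" if "k \<ge> 1" for k
    proof -
      have "1 / lam k \<le> 1 / l"
        using l lr that by (simp add: frac_le)
      then have "\<nu> k \<le> 1 / l"
        using \<nu>[of k] by simp
      moreover have "\<xi> * (1 - \<alpha> k) \<le> 1"
        using \<xi> \<alpha>[of k] by (intro mult_le_one) auto
      ultimately have "\<xi> * (1 - \<alpha> k) * \<nu> k \<le> 1 * (1 / l)"
        using \<xi> \<alpha>[of k] \<nu>0[of k] by (intro mult_mono) auto
      then show ?thesis
        by (simp add: e_def mult_ac)
    qed
    \<comment> \<open>Strictness makes \<open>R - \<alpha>sup\<close> positive, so that powers of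
      \<open>R\<close> govern the rate.\<close>
    have \<alpha>R: "\<alpha>sup < R"
      by (rule limit_less_if_parameter_condition[OF \<alpha>_lim _ \<alpha>_le e0 e_le c0 cR cond])
        (use \<alpha> in auto)
    have PR: "P k \<le> R ^ k" for k
    proof -
      have "P k \<le> (\<Prod>j=1..k. R)"
        unfolding P_def using c0 cR by (intro prod_mono) (auto intro: less_imp_le)
      then show ?thesis by simp
    qed
    have D_step': "D (Suc k) \<le> \<alpha>sup * D k + R ^ k * M" if "k \<ge> 1" for k
      using D_step[OF that] mult_right_mono[OF PR[of k] M0] by simp
    define K where "K = D 1 + R * M / (R - \<alpha>sup)"
    have D_le: "D (Suc k) \<le> K * R ^ k" for k
      unfolding K_def using geometric_recursion_bound[OF \<alpha>sup0 \<alpha>R M0 D0 D_step'] .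

    have "converges_linearly x p"
    proof -
      \<comment> \<open>\<open>D_le\<close> starts at index 1: \<open>D 0\<close> covers the initial
        term, and the division by \<open>R\<close> compensates the shift of the exponent.\<close>
      define L where "L = D 0 + K / R"
      have "0 \<le> K"
        using D_le[of 0] D0[of 1] by simp
      have "D k \<le> L * R ^ k" for k
      proof (cases k)
        case 0
        then show ?thesis
          using \<open>0 \<le> K\<close> R by (simp add: L_def)
      next
        case (Suc j)
        have "L * R ^ k = D 0 * R ^ k + K * R ^ j"
          using R by (simp add: L_def Suc algebra_simps)
        moreover have "0 \<le> D 0 * R ^ k"
          using D0 R by simp
        ultimately show ?thesis
          using D_le[of j] Suc by simp
      qed
      then have "sqrt (D k) \<le> sqrt (L * R ^ k)" for k
        by simp
      then have "norm (x k - p) \<le> sqrt L * sqrt R ^ k" for k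
        by (simp add: D_def real_sqrt_mult real_sqrt_power)
      then show ?thesis
        unfolding converges_linearly_def using R
        by (intro exI[of _ "sqrt L"] exI[of _ "sqrt R"]) auto
    qed
    \<comment> \<open>Equal starting points remove the increment from \<open>C 1\<close>, hence
      \<open>M \<le> D 1\<close>. For \<open>x 1 = p\<close> the right-hand side vanishes, whereas
      some \<open>x 0 \<noteq> p\<close> could push later iterates away from \<open>p\<close> when
      \<open>\<alpha> 1 > 0\<close>.\<close>
    moreover have "D (Suc k) \<le> (R ^ Suc k - \<alpha>sup ^ Suc k) / (R - \<alpha>sup) * D 1"
      if "x 0 = x 1" for k
    proof (rule geometric_recursion_exact_bound[OF \<alpha>sup0])
      have "C 1 \<le> D 1"
        using that \<alpha>[of 0] D0[of 0] by (simp add: C_def)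
      then have "M \<le> D 1"
        using D0[of 1] by (simp add: M_def)
      then have "R ^ k * M \<le> R ^ k * D 1" for k
        using R by (intro mult_left_mono) auto
      then show "D (Suc k) \<le> \<alpha>sup * D k + R ^ k * D 1" if "k \<ge> 1" for k
        using D_step'[OF that] by (meson add_left_mono order_trans)
    qed (use \<alpha>R in simp)
    moreover have "(\<lambda>k. (R ^ (k + 1) - \<alpha>sup ^ (k + 1)) / (R - \<alpha>sup) * D 1) \<in> O(\<lambda>k. R ^ k)"
    proof (rule bigoI[of _ "R / (R - \<alpha>sup) * D 1"], rule always_eventually, rule allI)
      fix k
      have "\<alpha>sup ^ (k + 1) \<le> R ^ (k + 1)" "0 \<le> \<alpha>sup ^ (k + 1)"
        using \<alpha>sup0 \<alpha>R by (auto intro!: power_mono simp del: power_Suc)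
      then have "\<bar>R ^ (k + 1) - \<alpha>sup ^ (k + 1)\<bar> \<le> R * R ^ k"
        by simp
      then have "\<bar>R ^ (k + 1) - \<alpha>sup ^ (k + 1)\<bar> * (D 1 / (R - \<alpha>sup))
          \<le> R * R ^ k * (D 1 / (R - \<alpha>sup))"
        using \<alpha>R D0[of 1] by (intro mult_right_mono) auto
      then show "norm ((R ^ (k + 1) - \<alpha>sup ^ (k + 1)) / (R - \<alpha>sup) * D 1)
          \<le> R / (R - \<alpha>sup) * D 1 * norm (R ^ k)"
        using \<alpha>R R D0[of 1] by (simp add: abs_mult mult_ac)
    qed
    moreover have "(\<lambda>k. D (k + 1)) \<in> O(\<lambda>k. R ^ k)"
      using D_le D0 R by (intro bigoI[of _ K] always_eventually allI) simp
    ultimately show ?thesis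
      using \<alpha>R by (simp add: R_def D_def)
  qed
  ultimately show ?thesis
    by blast
qed

end
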